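(* Let $n\ge 2$. The groups $WB_n/\Gamma_2(WP_n)$ and $UVB_n/\Gamma_2(UVP_n)$ are isomorphic to $VB_n/\Gamma_2(VP_n)$.
   Context: $\Gamma_2(H)=[H,H]$. The virtual braid group $VB_n$ is the group with generators $\sigma_i,\rho_i$ ($1\le i\le n-1$) and relations: $\sigma_i\sigma_{i+1}\sigma_i=\sigma_{i+1}\sigma_i\sigma_{i+1}$, $\rho_i\rho_{i+1}\rho_i=\rho_{i+1}\rho_i\rho_{i+1}$, $\rho_i\rho_{i+1}\sigma_i=\sigma_{i+1}\rho_i\rho_{i+1}$ for $1\le i\le n-2$; $\rho_i^2=1$ for $1\le i\le n-1$; and $\sigma_i\sigma_j=\sigma_j\sigma_i$, $\rho_i\rho_j=\rho_j\rho_i$, $\sigma_i\rho_j=\rho_j\sigma_i$ for $|i-j|\ge 2$. The welded braid group $WB_n$ is the quotient of $VB_n$ by the relations $\rho_i\sigma_{i+1}\sigma_i=\sigma_{i+1}\sigma_i\rho_{i+1}$, $1\le i\le n-2$. The unrestricted virtual braid group $UVB_n$ is the quotient of $WB_n$ by the relations $\rho_{i+1}\sigma_i\sigma_{i+1}=\sigma_i\sigma_{i+1}\rho_i$, $1\le i\le n-2$. The pure subgroups $VP_n$, $WP_n$, $UVP_n$ are the kernels of the homomorphisms from $VB_n$, $WB_n$, $UVB_n$, respectively, to $S_n$ given by $\sigma_i,\rho_i\mapsto(i,i+1)$. *)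

theory Defs
  imports "HOL-Algebra.Sym_Groups"
begin

section \<open>Group presentations\<close>

text \<open>A letter \<open>(x, True)\<close> stands for the generator \<open>x\<close> and \<open>(x, False)\<close> for its formal
  inverse. A relation \<open>u = v\<close> is encoded as the pair of words \<open>(u, v)\<close>.\<close>

type_synonym 'a word = "('a \<times> bool) list"

definition words :: "'a set \<Rightarrow> 'a word set" where
  "words X = lists (X \<times> UNIV)"

inductive_set word_cong :: "'a set \<Rightarrow> ('a word \<times> 'a word) set \<Rightarrow> ('a word \<times> 'a word) set"
  for X :: "'a set" and R :: "('a word \<times> 'a word) set" where
  refl: "w \<in> words X \<Longrightarrow> (w, w) \<in> word_cong X R"
| sym: "(u, v) \<in> word_cong X R \<Longrightarrow> (v, u) \<in> word_cong X R"
| trans: "(u, v) \<in> word_cong X R \<Longrightarrow> (v, w) \<in> word_cong X R \<Longrightarrow> (u, w) \<in> word_cong X R"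
| cancel: "x \<in> X \<Longrightarrow> a \<in> words X \<Longrightarrow> b \<in> words X \<Longrightarrow>
    (a @ [(x, e), (x, \<not> e)] @ b, a @ b) \<in> word_cong X R"
| rel: "(u, v) \<in> R \<Longrightarrow> u \<in> words X \<Longrightarrow> v \<in> words X \<Longrightarrow> a \<in> words X \<Longrightarrow> b \<in> words X \<Longrightarrow>
    (a @ u @ b, a @ v @ b) \<in> word_cong X R"

text \<open>The group \<open>\<langle>X | R\<rangle>\<close>: words over \<open>X\<close> and the formal inverses, modulo the congruence
  generated by free cancellation and by the relations in \<open>R\<close>.\<close>

definition presented_group :: "'a set \<Rightarrow> ('a word \<times> 'a word) set \<Rightarrow> 'a word set monoid" where
  "presented_group X R =
    \<lparr>carrier = words X // word_cong X R,
     monoid.mult = (\<lambda>A B. \<Union>a\<in>A. \<Union>b\<in>B. word_cong X R `` {a @ b}),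
     one = word_cong X R `` {[]}\<rparr>"

primrec word_eval :: "('b, 'm) monoid_scheme \<Rightarrow> ('a \<Rightarrow> 'b) \<Rightarrow> 'a word \<Rightarrow> 'b" where
  "word_eval H f [] = \<one>\<^bsub>H\<^esub>"
| "word_eval H f (l # w) =
    (if snd l then f (fst l) else inv\<^bsub>H\<^esub> (f (fst l))) \<otimes>\<^bsub>H\<^esub> word_eval H f w"

text \<open>The homomorphism out of a presented group that is prescribed by \<open>f\<close> on the generators;
  the image of a class under \<open>word_eval H f\<close> is a singleton as soon as \<open>f\<close> respects the
  relations (see \<open>induced_hom_class\<close> below).\<close>

definition induced_hom :: "('b, 'm) monoid_scheme \<Rightarrow> ('a \<Rightarrow> 'b) \<Rightarrow> 'a word set \<Rightarrow> 'b" where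
  "induced_hom H f C = the_elem (word_eval H f ` C)"


lemma words_simps [simp]:
  "[] \<in> words X"
  "l # w \<in> words X \<longleftrightarrow> fst l \<in> X \<and> w \<in> words X"
  "u @ v \<in> words X \<longleftrightarrow> u \<in> words X \<and> v \<in> words X"
  by (auto simp: words_def mem_Times_iff)

lemma word_cong_words: "(u, v) \<in> word_cong X R \<Longrightarrow> u \<in> words X \<and> v \<in> words X"
  by (induction rule: word_cong.induct) auto

lemma equiv_word_cong: "equiv (words X) (word_cong X R)"
proof (rule equivI)
  show "word_cong X R \<subseteq> words X \<times> words X"
    by (auto dest: word_cong_words)
  show "refl_on (words X) (word_cong X R)"
    by (rule refl_onI) (rule word_cong.refl)
  show "sym (word_cong X R)"
    by (rule symI) (rule word_cong.sym)
  show "trans (word_cong X R)"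
    by (rule transI) (rule word_cong.trans)
qed

lemma word_cong_context:
  assumes "(u, v) \<in> word_cong X R" "c \<in> words X" "d \<in> words X"
  shows "(c @ u @ d, c @ v @ d) \<in> word_cong X R"
  using assms
proof (induction rule: word_cong.induct)
  case (cancel x a b e)
  then show ?case
    using word_cong.cancel[of x X "c @ a" "b @ d" e R] by simp
next
  case (rel u v a b)
  then show ?case
    using word_cong.rel[of u v R X "c @ a" "b @ d"] by simp
next
  case (trans u v w)
  show ?case by (rule word_cong.trans[OF trans.IH]) (use trans.prems in simp_all)
next
  case (sym u v)
  show ?case by (rule word_cong.sym[OF sym.IH]) (use sym.prems in simp_all)
qed (simp add: word_cong.refl)

lemma word_cong_append:
  assumes "(u, u') \<in> word_cong X R" "(v, v') \<in> word_cong X R"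
  shows "(u @ v, u' @ v') \<in> word_cong X R"
proof (rule word_cong.trans)
  show "(u @ v, u' @ v) \<in> word_cong X R"
    using word_cong_context[OF assms(1), of "[]" v] word_cong_words[OF assms(2)] by simp
  show "(u' @ v, u' @ v') \<in> word_cong X R"
    using word_cong_context[OF assms(2), of u' "[]"] word_cong_words[OF assms(1)] by simp
qed

lemma class_mult:
  assumes "u \<in> words X" "v \<in> words X"
  shows "word_cong X R `` {u} \<otimes>\<^bsub>presented_group X R\<^esub> word_cong X R `` {v} =
    word_cong X R `` {u @ v}"
proof -
  have "word_cong X R `` {a @ b} = word_cong X R `` {u @ v}"
    if "a \<in> word_cong X R `` {u}" "b \<in> word_cong X R `` {v}" for a b
  proof -
    have "(u @ v, a @ b) \<in> word_cong X R"
      using that by (intro word_cong_append) simp_all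
    then show ?thesis
      by (rule equiv_class_eq[OF equiv_word_cong, symmetric])
  qed
  then have "(\<Union>a\<in>word_cong X R `` {u}. \<Union>b\<in>word_cong X R `` {v}. word_cong X R `` {a @ b}) =
      (\<Union>a\<in>word_cong X R `` {u}. \<Union>b\<in>word_cong X R `` {v}. word_cong X R `` {u @ v})"
    by (intro SUP_cong HOL.refl)
  moreover have "word_cong X R `` {u} \<noteq> {}" "word_cong X R `` {v} \<noteq> {}"
    using word_cong.refl[OF assms(1)] word_cong.refl[OF assms(2)] by blast+
  ultimately show ?thesis
    unfolding presented_group_def by simp
qed

definition word_inv :: "'a word \<Rightarrow> 'a word" where
  "word_inv w = rev (map (\<lambda>l. (fst l, \<not> snd l)) w)"

lemma word_inv_cong:
  "w \<in> words X \<Longrightarrow> word_inv w \<in> words X \<and> (word_inv w @ w, []) \<in> word_cong X R"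
proof (induction w)
  case (Cons l w)
  then have w: "fst l \<in> X" "w \<in> words X" "word_inv w \<in> words X"
    "(word_inv w @ w, []) \<in> word_cong X R"
    by auto
  have eq: "word_inv (l # w) = word_inv w @ [(fst l, \<not> snd l)]"
    by (simp add: word_inv_def)
  have "(word_inv (l # w) @ l # w, word_inv w @ w) \<in> word_cong X R"
    using word_cong.cancel[OF w(1,3,2), of "\<not> snd l" R] by (simp add: eq)
  then have "(word_inv (l # w) @ l # w, []) \<in> word_cong X R"
    using w(4) by (rule word_cong.trans)
  then show ?case
    using w by (simp add: eq)
qed (auto simp: word_inv_def intro: word_cong.refl)

lemma presented_group_carrier:
  "carrier (presented_group X R) = (\<lambda>w. word_cong X R `` {w}) ` words X"
  by (auto simp: presented_group_def quotient_def)

lemma group_presented_group: "group (presented_group X R)"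
proof (rule groupI)
  have one: "\<one>\<^bsub>presented_group X R\<^esub> = word_cong X R `` {[]}"
    by (simp add: presented_group_def)
  fix x assume "x \<in> carrier (presented_group X R)"
  then obtain u where u: "u \<in> words X" "x = word_cong X R `` {u}"
    by (auto simp: presented_group_carrier)
  show "\<one>\<^bsub>presented_group X R\<^esub> \<otimes>\<^bsub>presented_group X R\<^esub> x = x"
    using u by (simp add: one class_mult)
  have "word_cong X R `` {word_inv u} \<otimes>\<^bsub>presented_group X R\<^esub> x = \<one>\<^bsub>presented_group X R\<^esub>"
    using u word_inv_cong[OF u(1), of R]
    by (simp add: one class_mult equiv_class_eq[OF equiv_word_cong])
  then show "\<exists>y\<in>carrier (presented_group X R).
      y \<otimes>\<^bsub>presented_group X R\<^esub> x = \<one>\<^bsub>presented_group X R\<^esub>"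
    using word_inv_cong[OF u(1), of R] by (auto simp: presented_group_carrier)
  fix y assume "y \<in> carrier (presented_group X R)"
  then obtain v where v: "v \<in> words X" "y = word_cong X R `` {v}"
    by (auto simp: presented_group_carrier)
  show "x \<otimes>\<^bsub>presented_group X R\<^esub> y \<in> carrier (presented_group X R)"
    using u v by (auto simp: class_mult presented_group_carrier)
  fix z assume "z \<in> carrier (presented_group X R)"
  then obtain w where w: "w \<in> words X" "z = word_cong X R `` {w}"
    by (auto simp: presented_group_carrier)
  show "x \<otimes>\<^bsub>presented_group X R\<^esub> y \<otimes>\<^bsub>presented_group X R\<^esub> z =
      x \<otimes>\<^bsub>presented_group X R\<^esub> (y \<otimes>\<^bsub>presented_group X R\<^esub> z)"
    using u v w by (simp add: class_mult)
qed (auto simp: presented_group_def quotientI)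

context
  fixes H :: "('b, 'm) monoid_scheme" and f :: "'a \<Rightarrow> 'b"
    and X :: "'a set" and R :: "('a word \<times> 'a word) set"
  assumes H: "group H" and f: "f \<in> X \<rightarrow> carrier H"
    and R: "\<And>u v. (u, v) \<in> R \<Longrightarrow> word_eval H f u = word_eval H f v"
begin

interpretation H: group H by (rule H)

lemma word_eval_closed: "w \<in> words X \<Longrightarrow> word_eval H f w \<in> carrier H"
  using f by (induction w) (auto simp: Pi_iff)

lemma word_eval_append:
  "u \<in> words X \<Longrightarrow> v \<in> words X \<Longrightarrow>
    word_eval H f (u @ v) = word_eval H f u \<otimes>\<^bsub>H\<^esub> word_eval H f v"
  using f by (induction u) (auto simp: Pi_iff word_eval_closed H.m_assoc)

lemma word_eval_cong: "(u, v) \<in> word_cong X R \<Longrightarrow> word_eval H f u = word_eval H f v"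
proof (induction rule: word_cong.induct)
  case (cancel x a b e)
  then have "f x \<in> carrier H" using f by auto
  then have "word_eval H f ([(x, e), (x, \<not> e)] @ b) = word_eval H f b"
    using cancel by (auto simp: word_eval_closed H.m_assoc[symmetric])
  then show ?case
    using cancel by (simp add: word_eval_append[of a "(x, e) # (x, \<not> e) # b"] word_eval_append[of a b])
next
  case (rel u v a b)
  then show ?case by (simp add: word_eval_append R)
qed auto

lemma induced_hom_class:
  assumes "w \<in> words X"
  shows "induced_hom H f (word_cong X R `` {w}) = word_eval H f w"
proof -
  have "word_eval H f ` (word_cong X R `` {w}) = {word_eval H f w}"
    using assms word_eval_cong word_cong.refl by fastforce
  then show ?thesis by (simp add: induced_hom_def)
qed

lemma induced_hom_gen:
  "x \<in> X \<Longrightarrow> induced_hom H f (word_cong X R `` {[(x, True)]}) = f x"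
  using f by (auto simp: induced_hom_class Pi_iff)

lemma induced_hom_hom: "induced_hom H f \<in> hom (presented_group X R) H"
  by (rule homI)
    (auto simp: presented_group_carrier class_mult induced_hom_class word_eval_closed word_eval_append)

end


section \<open>Virtual, welded and unrestricted virtual braid groups\<close>

datatype braid_gen = GenSigma nat | GenRho nat

definition braid_gens :: "nat \<Rightarrow> braid_gen set" where
  "braid_gens n = GenSigma ` {i. 1 \<le> i \<and> i + 1 \<le> n} \<union> GenRho ` {i. 1 \<le> i \<and> i + 1 \<le> n}"

abbreviation sg :: "nat \<Rightarrow> braid_gen \<times> bool" where "sg i \<equiv> (GenSigma i, True)"
abbreviation rh :: "nat \<Rightarrow> braid_gen \<times> bool" where "rh i \<equiv> (GenRho i, True)"

definition VB_rels :: "nat \<Rightarrow> (braid_gen word \<times> braid_gen word) set" where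
  "VB_rels n =
     {([sg i, sg (i+1), sg i], [sg (i+1), sg i, sg (i+1)]) | i. 1 \<le> i \<and> i + 2 \<le> n}
   \<union> {([rh i, rh (i+1), rh i], [rh (i+1), rh i, rh (i+1)]) | i. 1 \<le> i \<and> i + 2 \<le> n}
   \<union> {([rh i, rh (i+1), sg i], [sg (i+1), rh i, rh (i+1)]) | i. 1 \<le> i \<and> i + 2 \<le> n}
   \<union> {([rh i, rh i], []) | i. 1 \<le> i \<and> i + 1 \<le> n}
   \<union> {([sg i, sg j], [sg j, sg i]) | i j.
        1 \<le> i \<and> i + 1 \<le> n \<and> 1 \<le> j \<and> j + 1 \<le> n \<and> \<bar>int i - int j\<bar> \<ge> 2}
   \<union> {([rh i, rh j], [rh j, rh i]) | i j.
        1 \<le> i \<and> i + 1 \<le> n \<and> 1 \<le> j \<and> j + 1 \<le> n \<and> \<bar>int i - int j\<bar> \<ge> 2}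
   \<union> {([sg i, rh j], [rh j, sg i]) | i j.
        1 \<le> i \<and> i + 1 \<le> n \<and> 1 \<le> j \<and> j + 1 \<le> n \<and> \<bar>int i - int j\<bar> \<ge> 2}"

text \<open>The quotients \<open>WB\<^sub>n\<close> and \<open>UVB\<^sub>n\<close> are presented by adjoining the extra relations
  to those of \<open>VB\<^sub>n\<close> on the same generators.\<close>

definition WB_rels :: "nat \<Rightarrow> (braid_gen word \<times> braid_gen word) set" where
  "WB_rels n = VB_rels n
   \<union> {([rh i, sg (i+1), sg i], [sg (i+1), sg i, rh (i+1)]) | i. 1 \<le> i \<and> i + 2 \<le> n}"

definition UVB_rels :: "nat \<Rightarrow> (braid_gen word \<times> braid_gen word) set" where
  "UVB_rels n = WB_rels n
   \<union> {([rh (i+1), sg i, sg (i+1)], [sg i, sg (i+1), rh i]) | i. 1 \<le> i \<and> i + 2 \<le> n}"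

definition VB :: "nat \<Rightarrow> braid_gen word set monoid" where
  "VB n = presented_group (braid_gens n) (VB_rels n)"

definition WB :: "nat \<Rightarrow> braid_gen word set monoid" where
  "WB n = presented_group (braid_gens n) (WB_rels n)"

definition UVB :: "nat \<Rightarrow> braid_gen word set monoid" where
  "UVB n = presented_group (braid_gens n) (UVB_rels n)"

primrec gen_perm :: "braid_gen \<Rightarrow> nat \<Rightarrow> nat" where
  "gen_perm (GenSigma i) = transpose i (i + 1)"
| "gen_perm (GenRho i) = transpose i (i + 1)"

definition braid_perm :: "nat \<Rightarrow> braid_gen word set \<Rightarrow> nat \<Rightarrow> nat" where
  "braid_perm n = induced_hom (sym_group n) gen_perm"

definition VP :: "nat \<Rightarrow> braid_gen word set set" where
  "VP n = kernel (VB n) (sym_group n) (braid_perm n)"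

definition WP :: "nat \<Rightarrow> braid_gen word set set" where
  "WP n = kernel (WB n) (sym_group n) (braid_perm n)"

definition UVP :: "nat \<Rightarrow> braid_gen word set set" where
  "UVP n = kernel (UVB n) (sym_group n) (braid_perm n)"


lemma gen_perm_closed: "gen_perm \<in> braid_gens n \<rightarrow> carrier (sym_group n)"
  by (auto simp: braid_gens_def sym_group_carrier intro!: permutes_swap_id)

lemma UVB_rels_words: "UVB_rels n \<subseteq> words (braid_gens n) \<times> words (braid_gens n)"
  by (auto simp: UVB_rels_def WB_rels_def VB_rels_def braid_gens_def)

lemma transpose_braid:
  "transpose i (Suc i) \<circ> (transpose (Suc i) (Suc (Suc i)) \<circ> transpose i (Suc i)) =
    transpose (Suc i) (Suc (Suc i)) \<circ> (transpose i (Suc i) \<circ> transpose (Suc i) (Suc (Suc i)))"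
  by (rule ext) (simp add: Transposition.transpose_def)

lemma transpose_commute_far:
  assumes "\<bar>int i - int j\<bar> \<ge> 2"
  shows "transpose i (Suc i) \<circ> transpose j (Suc j) = transpose j (Suc j) \<circ> transpose i (Suc i)"
proof -
  have "i \<noteq> j" "i \<noteq> Suc j" "Suc i \<noteq> j" using assms by auto
  then show ?thesis by (intro ext) (simp add: Transposition.transpose_def)
qed

lemma UVB_rels_perm:
  assumes "(u, v) \<in> UVB_rels n"
  shows "word_eval (sym_group n) gen_perm u = word_eval (sym_group n) gen_perm v"
  using assms unfolding UVB_rels_def WB_rels_def VB_rels_def
  by (elim UnE CollectE exE conjE Pair_inject)
    (simp_all add: sym_group_mult sym_group_one transpose_braid transpose_commute_far)

lemma braid_perm_hom:
  "braid_perm n \<in> hom (VB n) (sym_group n)"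
  "braid_perm n \<in> hom (WB n) (sym_group n)"
  "braid_perm n \<in> hom (UVB n) (sym_group n)"
  unfolding braid_perm_def VB_def WB_def UVB_def
  by (rule induced_hom_hom[OF sym_group_is_group gen_perm_closed], rule UVB_rels_perm,
      simp add: UVB_rels_def WB_rels_def)+

lemma braid_perm_gen:
  assumes "x \<in> braid_gens n" "R \<subseteq> UVB_rels n"
  shows "braid_perm n (word_cong (braid_gens n) R `` {[(x, True)]}) = gen_perm x"
  unfolding braid_perm_def
  by (rule induced_hom_gen[OF sym_group_is_group gen_perm_closed _ assms(1)])
    (use assms(2) UVB_rels_perm in blast)

lemma group_braid: "group (VB n)" "group (WB n)" "group (UVB n)"
  by (simp_all add: VB_def WB_def UVB_def group_presented_group)

lemma pure_normal: "VP n \<lhd> VB n" "WP n \<lhd> WB n" "UVP n \<lhd> UVB n"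
  unfolding VP_def WP_def UVP_def
  by (intro group_hom.normal_kernel group_hom.intro group_hom_axioms.intro
      group_braid sym_group_is_group braid_perm_hom)+

lemma derived_pure_normal:
  "derived (VB n) (VP n) \<lhd> VB n"
  "derived (WB n) (WP n) \<lhd> WB n"
  "derived (UVB n) (UVP n) \<lhd> UVB n"
  by (intro group.derived_is_normal group_braid pure_normal)+

end

theory Submission
  imports Defs
begin

text \<open>
  Write \<open>a = \<sigma>\<^sub>i\<close>, \<open>b = \<sigma>\<^sub>i\<^sub>+\<^sub>1\<close>, \<open>r = \<rho>\<^sub>i\<close>, \<open>s = \<rho>\<^sub>i\<^sub>+\<^sub>1\<close>. The elements \<open>x = ar\<close> and \<open>y = bs\<close> of
  \<open>VB\<^sub>n\<close> are pure, and so are their conjugates \<open>sxs\<close> and \<open>ryr\<close>. The relation \<open>rsa = brs\<close> says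
  that \<open>y\<close> is the conjugate of \<open>x\<close> by \<open>rs\<close>, and pushing all the involutions \<open>r, s\<close> to the right
  gives

    \<^item> \<open>rba = (ryr)y \<cdot> rsr\<close> and \<open>bas = y(ryr) \<cdot> rsr\<close>,
    \<^item> \<open>sab = (sxs)x \<cdot> rsr\<close> and \<open>abr = x(sxs) \<cdot> rsr\<close>.

  So the welded relation \<open>rba = bas\<close> and the unrestricted relation \<open>sab = abr\<close> each say that a
  certain pair of pure elements commutes, and both hold in \<open>VB\<^sub>n/\<Gamma>\<^sub>2(VP\<^sub>n)\<close>
  (\<open>welded_iff_commute\<close>, \<open>unrestricted_iff_commute\<close>, \<open>UVB_rels_mod_derived\<close>).

  Let \<open>K\<close> be \<open>VB\<^sub>n\<close> with some of these relations adjoined, and \<open>Q\<close> its pure subgroup. The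
  projection \<open>VB\<^sub>n \<rightarrow> K\<close> is onto and maps \<open>VP\<^sub>n\<close> onto \<open>Q\<close>, hence \<open>\<Gamma>\<^sub>2(VP\<^sub>n)\<close> onto \<open>\<Gamma>\<^sub>2(Q)\<close>.
  Its kernel lies in \<open>\<Gamma>\<^sub>2(VP\<^sub>n)\<close>, because a quotient of \<open>VB\<^sub>n\<close> in which the new relations hold is
  also a quotient of \<open>K\<close> (\<open>hom_respects_larger_cong\<close>). The two quotients are therefore
  isomorphic by the first isomorphism theorem (\<open>Mod_derived_iso\<close>).
\<close>


section \<open>Quotients by derived subgroups\<close>

lemma (in group) rcos_derived_commute:
  assumes N: "P \<lhd> G" and x: "x \<in> P" and y: "y \<in> P"
  shows "derived G P #> (x \<otimes> y) = derived G P #> (y \<otimes> x)"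
proof (rule coset_mult_inv1)
  interpret P: normal P G by (rule N)
  have [simp]: "x \<in> carrier G" "y \<in> carrier G"
    using x y P.subset by auto
  show "x \<otimes> y \<in> carrier G" "y \<otimes> x \<in> carrier G" by simp_all
  show "derived G P \<subseteq> carrier G"
    by (rule derived_in_carrier[OF P.subset])
  have "x \<otimes> y \<otimes> inv x \<otimes> inv y \<in> derived G P"
    unfolding derived_def using x y by (blast intro: generate.incl)
  then have "x \<otimes> y \<otimes> inv (y \<otimes> x) \<in> derived G P"
    by (simp add: inv_mult_group m_assoc)
  then show "derived G P #> (x \<otimes> y \<otimes> inv (y \<otimes> x)) = derived G P"
    by (intro coset_join2 derived_is_subgroup[OF P.subset]) simp_all
qed

text \<open>The composite \<open>G \<rightarrow> H \<rightarrow> H/\<Gamma>\<^sub>2(h(P))\<close> is onto with kernel \<open>\<Gamma>\<^sub>2(P) \<cdot> ker h\<close>, which is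
  \<open>\<Gamma>\<^sub>2(P)\<close> as soon as \<open>ker h\<close> is contained in it.\<close>

lemma (in group_hom) Mod_derived_iso:
  assumes surj: "h ` carrier G = carrier H"
    and P: "P \<subseteq> carrier G" and N: "derived H (h ` P) \<lhd> H"
    and ker: "kernel G H h \<subseteq> derived G P"
  shows "(H Mod derived H (h ` P)) \<cong> (G Mod derived G P)"
proof -
  let ?D = "derived H (h ` P)"
  let ?f = "\<lambda>x. ?D #>\<^bsub>H\<^esub> h x"
  interpret N: normal ?D H by (rule N)
  interpret D: subgroup "derived G P" G by (rule G.derived_is_subgroup[OF P])
  interpret f: group_hom G "H Mod ?D" ?f
  proof (intro group_hom.intro group_hom_axioms.intro)
    show "?f \<in> hom G (H Mod ?D)"
      using Group.hom_compose[OF homh N.r_coset_hom_Mod] by (simp add: comp_def)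
  qed (rule G.is_group, rule N.factorgroup_is_group)
  have onto: "?f ` carrier G = carrier (H Mod ?D)"
    by (simp add: carrier_FactGroup flip: surj) (simp add: image_image)
  have "x \<in> derived G P" if x: "x \<in> carrier G" and fx: "?D #>\<^bsub>H\<^esub> h x = ?D" for x
  proof -
    have "h x \<in> ?D"
      by (rule H.coset_join1[OF fx hom_closed[OF x] N.subgroup_axioms])
    then obtain d where d: "d \<in> derived G P" "h x = h d"
      by (auto simp: derived_img[OF P])
    then have dG: "d \<in> carrier G" by simp
    have "x \<otimes> inv d \<in> kernel G H h"
      using x d dG by (simp add: kernel_def)
    then have "x \<otimes> inv d \<otimes> d \<in> derived G P"
      using ker d by blast
    then show ?thesis using x dG by (simp add: G.m_assoc)
  qed
  moreover have "?D #>\<^bsub>H\<^esub> h x = ?D" if "x \<in> derived G P" for x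
    using that by (intro H.coset_join2 N.subgroup_axioms) (auto simp: derived_img[OF P])
  ultimately have "kernel G (H Mod ?D) ?f = derived G P"
    by (auto simp: kernel_def)
  then have "(G Mod derived G P) \<cong> (H Mod ?D)"
    using f.FactGroup_iso_set[OF onto] by (auto simp: is_iso_def)
  then show ?thesis
    by (rule group.iso_sym[rotated])
      (rule normal.factorgroup_is_group,
        use f.normal_kernel \<open>kernel G (H Mod ?D) ?f = derived G P\<close> in simp)
qed


section \<open>Adjoining relations to a presentation\<close>

abbreviation word_class :: "'a set \<Rightarrow> ('a word \<times> 'a word) set \<Rightarrow> 'a word \<Rightarrow> 'a word set" where
  "word_class X R w \<equiv> word_cong X R `` {w}"

lemma word_class_eq: "(u, v) \<in> word_cong X R \<Longrightarrow> word_class X R u = word_class X R v"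
  by (rule equiv_class_eq[OF equiv_word_cong])

lemma word_cong_relI:
  "(u, v) \<in> R \<Longrightarrow> u \<in> words X \<Longrightarrow> v \<in> words X \<Longrightarrow> (u, v) \<in> word_cong X R"
  using word_cong.rel[of u v R X "[]" "[]"] by simp

lemma word_class_closed: "w \<in> words X \<Longrightarrow> word_class X R w \<in> carrier (presented_group X R)"
  by (simp add: presented_group_carrier)

text \<open>The universal property of \<open>\<langle>X | S\<rangle>\<close> relative to \<open>\<langle>X | R\<rangle>\<close>: a homomorphism that is
  defined on \<open>\<langle>X | R\<rangle>\<close> and identifies the two sides of each relation in \<open>S\<close> is compatible with the
  whole congruence generated by \<open>S\<close>.\<close>

lemma hom_respects_larger_cong:
  assumes h: "h \<in> hom (presented_group X R) H"
    and S: "\<And>u v. (u, v) \<in> S \<Longrightarrow> u \<in> words X \<Longrightarrow> v \<in> words X \<Longrightarrow>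
      h (word_class X R u) = h (word_class X R v)"
    and uv: "(u, v) \<in> word_cong X S"
  shows "h (word_class X R u) = h (word_class X R v)"
  using uv
proof (induction rule: word_cong.induct)
  case (cancel x a b e)
  then show ?case
    by (intro arg_cong[where f = h] word_class_eq word_cong.cancel)
next
  case (rel u v a b)
  have "h (word_class X R (a @ w @ b)) =
      h (word_class X R a) \<otimes>\<^bsub>H\<^esub> (h (word_class X R w) \<otimes>\<^bsub>H\<^esub> h (word_class X R b))"
    if "w \<in> words X" for w
    using that rel
    by (simp add: word_class_closed class_mult flip: hom_mult[OF h])
  then show ?case using rel S by simp
qed simp_all

lemma word_cong_mono:
  assumes "R \<subseteq> S"
  shows "word_cong X R \<subseteq> word_cong X S"
proof (rule subrelI)
  fix u v assume "(u, v) \<in> word_cong X R"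
  then show "(u, v) \<in> word_cong X S"
  proof (induction rule: word_cong.induct)
    case (cancel x a b e)
    then show ?case by (rule word_cong.cancel)
  next
    case (rel u v a b)
    then show ?case using assms by (intro word_cong.rel) auto
  qed (blast intro: word_cong.refl word_cong.sym word_cong.trans)+
qed

text \<open>The projection \<open>\<langle>X | R\<rangle> \<rightarrow> \<langle>X | S\<rangle>\<close> sends a class of words to its saturation under the
  larger congruence, so it is a plain relational image.\<close>

lemma Image_word_class:
  assumes "R \<subseteq> S" "w \<in> words X"
  shows "word_cong X S `` word_class X R w = word_class X S w"
proof
  show "word_cong X S `` word_class X R w \<subseteq> word_class X S w"
    using word_cong_mono[OF assms(1), of X] by (blast intro: word_cong.trans)
  show "word_class X S w \<subseteq> word_cong X S `` word_class X R w"
    using word_cong.refl[OF assms(2), of R] by blast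
qed

lemma projection_hom:
  assumes "R \<subseteq> S"
  shows "(``) (word_cong X S) \<in> hom (presented_group X R) (presented_group X S)"
proof (rule homI)
  fix x y assume "x \<in> carrier (presented_group X R)" "y \<in> carrier (presented_group X R)"
  then obtain u v where uv: "u \<in> words X" "v \<in> words X"
    "x = word_class X R u" "y = word_class X R v"
    by (auto simp: presented_group_carrier)
  then show "word_cong X S `` x \<in> carrier (presented_group X S)"
    by (simp only: Image_word_class[OF assms] word_class_closed)
  show "word_cong X S `` (x \<otimes>\<^bsub>presented_group X R\<^esub> y) =
      word_cong X S `` x \<otimes>\<^bsub>presented_group X S\<^esub> word_cong X S `` y"
    using uv by (simp only: Image_word_class[OF assms] class_mult words_simps)
qed

lemma projection_onto:
  assumes "R \<subseteq> S"
  shows "(``) (word_cong X S) ` carrier (presented_group X R) = carrier (presented_group X S)"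
  by (simp add: presented_group_carrier image_image Image_word_class[OF assms])


section \<open>The additional relations as commutation relations\<close>

context group
begin

text \<open>Solve \<open>mix\<close> for \<open>a\<close>. With \<open>y = bs\<close> the sides of the welded relation are then
  \<open>(ryr)y \<cdot> rsr\<close> and \<open>y(ryr) \<cdot> rsr\<close>, and the common factor cancels.\<close>

lemma welded_iff_commute:
  assumes [simp]: "a \<in> carrier G" "b \<in> carrier G" "r \<in> carrier G" "s \<in> carrier G"
    and rr: "r \<otimes> r = \<one>" and ss: "s \<otimes> s = \<one>"
    and rsr: "r \<otimes> (s \<otimes> r) = s \<otimes> (r \<otimes> s)"
    and mix: "r \<otimes> (s \<otimes> a) = b \<otimes> (r \<otimes> s)"
  shows "r \<otimes> (b \<otimes> a) = b \<otimes> (a \<otimes> s) \<longleftrightarrow>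
    (r \<otimes> (b \<otimes> (s \<otimes> r))) \<otimes> (b \<otimes> s) = (b \<otimes> s) \<otimes> (r \<otimes> (b \<otimes> (s \<otimes> r)))"
proof -
  have rr': "r \<otimes> (r \<otimes> z) = z" and ss': "s \<otimes> (s \<otimes> z) = z" if "z \<in> carrier G" for z
    using that by (simp_all add: rr ss flip: m_assoc)
  have rsr': "r \<otimes> (s \<otimes> (r \<otimes> z)) = s \<otimes> (r \<otimes> (s \<otimes> z))" if "z \<in> carrier G" for z
    using that rsr by (metis assms(3,4) m_assoc m_closed)
  have a: "a = s \<otimes> (r \<otimes> (b \<otimes> (r \<otimes> s)))"
    by (simp add: rr' ss' flip: mix)
  have "r \<otimes> (b \<otimes> a) = (r \<otimes> (b \<otimes> (s \<otimes> r))) \<otimes> (b \<otimes> s) \<otimes> (s \<otimes> (r \<otimes> s))"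
    by (subst a) (simp add: m_assoc rr rr' ss ss' rsr rsr')
  moreover have "b \<otimes> (a \<otimes> s) = (b \<otimes> s) \<otimes> (r \<otimes> (b \<otimes> (s \<otimes> r))) \<otimes> (s \<otimes> (r \<otimes> s))"
    by (subst a) (simp add: m_assoc rr rr' ss ss' rsr rsr')
  ultimately show ?thesis by simp
qed

text \<open>Here \<open>mix\<close> is solved for \<open>b\<close>. With \<open>x = ar\<close> the sides of the unrestricted relation are
  then \<open>(sxs)x \<cdot> rsr\<close> and \<open>x(sxs) \<cdot> rsr\<close>.\<close>

lemma unrestricted_iff_commute:
  assumes [simp]: "a \<in> carrier G" "b \<in> carrier G" "r \<in> carrier G" "s \<in> carrier G"
    and rr: "r \<otimes> r = \<one>" and ss: "s \<otimes> s = \<one>"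
    and rsr: "r \<otimes> (s \<otimes> r) = s \<otimes> (r \<otimes> s)"
    and mix: "r \<otimes> (s \<otimes> a) = b \<otimes> (r \<otimes> s)"
  shows "s \<otimes> (a \<otimes> b) = a \<otimes> (b \<otimes> r) \<longleftrightarrow>
    (s \<otimes> (a \<otimes> (r \<otimes> s))) \<otimes> (a \<otimes> r) = (a \<otimes> r) \<otimes> (s \<otimes> (a \<otimes> (r \<otimes> s)))"
proof -
  have rr': "r \<otimes> (r \<otimes> z) = z" and ss': "s \<otimes> (s \<otimes> z) = z" if "z \<in> carrier G" for z
    using that by (simp_all add: rr ss flip: m_assoc)
  have rsr': "r \<otimes> (s \<otimes> (r \<otimes> z)) = s \<otimes> (r \<otimes> (s \<otimes> z))" if "z \<in> carrier G" for z
    using that rsr by (metis assms(3,4) m_assoc m_closed)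
  have "b = b \<otimes> (r \<otimes> s) \<otimes> (s \<otimes> r)"
    by (simp add: m_assoc rr ss')
  then have b: "b = r \<otimes> (s \<otimes> (a \<otimes> (s \<otimes> r)))"
    by (simp add: m_assoc flip: mix)
  have "s \<otimes> (a \<otimes> b) = (s \<otimes> (a \<otimes> (r \<otimes> s))) \<otimes> (a \<otimes> r) \<otimes> (r \<otimes> (s \<otimes> r))"
    by (subst b) (simp add: m_assoc rr')
  moreover have "a \<otimes> (b \<otimes> r) = (a \<otimes> r) \<otimes> (s \<otimes> (a \<otimes> (r \<otimes> s))) \<otimes> (r \<otimes> (s \<otimes> r))"
    by (subst b) (simp add: m_assoc rr rr' ss ss' rsr rsr')
  ultimately show ?thesis by simp
qed

end


section \<open>Virtual braid groups modulo the commutators of pure braids\<close>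

abbreviation braid_class :: "nat \<Rightarrow> braid_gen word \<Rightarrow> braid_gen word set" where
  "braid_class n \<equiv> word_class (braid_gens n) (VB_rels n)"

lemma braid_perm_class:
  assumes "w \<in> words (braid_gens n)" "R \<subseteq> UVB_rels n"
  shows "braid_perm n (word_class (braid_gens n) R w) = word_eval (sym_group n) gen_perm w"
  unfolding braid_perm_def
  by (rule induced_hom_class[OF sym_group_is_group gen_perm_closed _ assms(1)])
    (use assms(2) UVB_rels_perm in blast)

lemma VB_rels_subset: "VB_rels n \<subseteq> UVB_rels n"
  by (auto simp: UVB_rels_def WB_rels_def)

lemma VP_iff:
  assumes "w \<in> words (braid_gens n)"
  shows "braid_class n w \<in> VP n \<longleftrightarrow> word_eval (sym_group n) gen_perm w = id"
  using assms
  by (auto simp: VP_def kernel_def VB_def presented_group_carrier sym_group_one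
      braid_perm_class[OF _ VB_rels_subset])

text \<open>The two elements whose commutation expresses an additional relation are conjugates of
  \<open>\<sigma>\<^sub>i\<rho>\<^sub>i\<close> or \<open>\<sigma>\<^sub>i\<^sub>+\<^sub>1\<rho>\<^sub>i\<^sub>+\<^sub>1\<close>, hence pure, and pure elements commute modulo \<open>\<Gamma>\<^sub>2(VP\<^sub>n)\<close>.\<close>

lemma UVB_rels_mod_derived:
  assumes uv: "(u, v) \<in> UVB_rels n"
  shows "derived (VB n) (VP n) #>\<^bsub>VB n\<^esub> braid_class n u =
    derived (VB n) (VP n) #>\<^bsub>VB n\<^esub> braid_class n v"
proof -
  let ?G = "VB n" and ?D = "derived (VB n) (VP n)" and ?W = "words (braid_gens n)"
  let ?H = "?G Mod ?D"
  define q where "q w = ?D #>\<^bsub>?G\<^esub> braid_class n w" for w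
  interpret G: group ?G by (rule group_braid)
  interpret D: normal ?D ?G by (rule derived_pure_normal)
  interpret H: group ?H by (rule D.factorgroup_is_group)
  have class_closed: "braid_class n w \<in> carrier ?G" if "w \<in> ?W" for w
    using that by (auto simp: VB_def presented_group_carrier)
  have class_append: "braid_class n (u @ v) = braid_class n u \<otimes>\<^bsub>?G\<^esub> braid_class n v"
    if "u \<in> ?W" "v \<in> ?W" for u v
    using that by (simp add: VB_def class_mult)
  have q_closed: "q w \<in> carrier ?H" if "w \<in> ?W" for w
    using class_closed[OF that] by (auto simp: q_def carrier_FactGroup)
  have q_append: "q (u @ v) = q u \<otimes>\<^bsub>?H\<^esub> q v" if "u \<in> ?W" "v \<in> ?W" for u v
    using that by (simp add: q_def class_append D.rcos_sum class_closed)
  have q_Cons: "q (l # l' # w) = q [l] \<otimes>\<^bsub>?H\<^esub> q (l' # w)"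
    if "fst l \<in> braid_gens n" "l' # w \<in> ?W" for l l' w
    using q_append[of "[l]" "l' # w"] that by simp
  have "braid_class n [] = \<one>\<^bsub>?G\<^esub>"
    by (simp add: VB_def presented_group_def)
  then have q_Nil: "q [] = \<one>\<^bsub>?H\<^esub>"
    by (simp add: q_def G.coset_mult_one D.subset)
  have q_rel: "q u = q v" if "(u, v) \<in> VB_rels n" for u v
  proof -
    have "u \<in> ?W \<and> v \<in> ?W"
      using that VB_rels_subset UVB_rels_words by blast
    then have "braid_class n u = braid_class n v"
      using that by (intro word_class_eq word_cong_relI) auto
    then show ?thesis by (simp add: q_def)
  qed
  have q_pure_commute: "q u \<otimes>\<^bsub>?H\<^esub> q v = q v \<otimes>\<^bsub>?H\<^esub> q u"
    if "u \<in> ?W" "v \<in> ?W"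
      "word_eval (sym_group n) gen_perm u = id" "word_eval (sym_group n) gen_perm v = id"
    for u v
  proof -
    have "braid_class n u \<in> VP n" "braid_class n v \<in> VP n"
      using that by (simp_all add: VP_iff)
    then have "?D #>\<^bsub>?G\<^esub> (braid_class n u \<otimes>\<^bsub>?G\<^esub> braid_class n v) =
        ?D #>\<^bsub>?G\<^esub> (braid_class n v \<otimes>\<^bsub>?G\<^esub> braid_class n u)"
      by (rule G.rcos_derived_commute[OF pure_normal(1)])
    then show ?thesis
      using that by (simp add: q_def D.rcos_sum class_closed)
  qed
  have "q [rh i, sg (i+1), sg i] = q [sg (i+1), sg i, rh (i+1)] \<and>
      q [rh (i+1), sg i, sg (i+1)] = q [sg i, sg (i+1), rh i]"
    if i: "1 \<le> i" "i + 2 \<le> n" for i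
  proof -
    let ?a = "q [sg i]" and ?b = "q [sg (i+1)]" and ?r = "q [rh i]" and ?s = "q [rh (i+1)]"
    have gens: "GenSigma i \<in> braid_gens n" "GenSigma (Suc i) \<in> braid_gens n"
      "GenRho i \<in> braid_gens n" "GenRho (Suc i) \<in> braid_gens n"
      using i by (auto simp: braid_gens_def)
    have closed: "?a \<in> carrier ?H" "?b \<in> carrier ?H" "?r \<in> carrier ?H" "?s \<in> carrier ?H"
      using gens by (auto intro: q_closed)
    have rels: "q [rh i, rh i] = q []" "q [rh (i+1), rh (i+1)] = q []"
      "q [rh i, rh (i+1), rh i] = q [rh (i+1), rh i, rh (i+1)]"
      "q [rh i, rh (i+1), sg i] = q [sg (i+1), rh i, rh (i+1)]"
      using i by (intro q_rel; force simp: VB_rels_def)+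
    note rels_H = rels[unfolded q_Nil]
    have pure_commute:
      "q [rh i, sg (i+1), rh (i+1), rh i] \<otimes>\<^bsub>?H\<^esub> q [sg (i+1), rh (i+1)] =
        q [sg (i+1), rh (i+1)] \<otimes>\<^bsub>?H\<^esub> q [rh i, sg (i+1), rh (i+1), rh i]"
      "q [rh (i+1), sg i, rh i, rh (i+1)] \<otimes>\<^bsub>?H\<^esub> q [sg i, rh i] =
        q [sg i, rh i] \<otimes>\<^bsub>?H\<^esub> q [rh (i+1), sg i, rh i, rh (i+1)]"
      by (rule q_pure_commute; simp add: gens sym_group_mult sym_group_one fun_eq_iff)+
    show ?thesis
      using H.welded_iff_commute[OF closed] H.unrestricted_iff_commute[OF closed]
        rels_H pure_commute gens
      by (simp add: q_Cons del: mult_FactGroup one_FactGroup)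
  qed
  then have "q u = q v"
    using uv q_rel unfolding UVB_rels_def WB_rels_def by blast
  then show ?thesis by (simp add: q_def)
qed

text \<open>The relations up to those of \<open>UVB\<^sub>n\<close> keep the permutation of a braid well defined, so \<open>Q\<close> is the
  image of \<open>VP\<^sub>n\<close>, and they hold modulo \<open>\<Gamma>\<^sub>2(VP\<^sub>n)\<close>, so the kernel of \<open>VB\<^sub>n \<rightarrow> K\<close> lies in
  \<open>\<Gamma>\<^sub>2(VP\<^sub>n)\<close>.\<close>

lemma VB_quotient_mod_derived_iso:
  assumes R: "VB_rels n \<subseteq> R" "R \<subseteq> UVB_rels n"
    and K: "K = presented_group (braid_gens n) R"
    and Q: "Q = kernel K (sym_group n) (braid_perm n)"
    and N: "derived K Q \<lhd> K"
  shows "(K Mod derived K Q) \<cong> (VB n Mod derived (VB n) (VP n))"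
proof -
  let ?X = "braid_gens n" and ?D = "derived (VB n) (VP n)"
  let ?p = "(``) (word_cong (braid_gens n) R)"
  interpret p: group_hom "VB n" K ?p
    using projection_hom[OF R(1)] group_presented_group
    by (intro group_hom.intro group_hom_axioms.intro) (auto simp: K VB_def)
  interpret D: normal ?D "VB n" by (rule derived_pure_normal)
  have onto: "?p ` carrier (VB n) = carrier K"
    by (simp add: K VB_def projection_onto[OF R(1)])
  have perm: "braid_perm n (?p g) = braid_perm n g" if "g \<in> carrier (VB n)" for g
    using that R by (auto simp: VB_def presented_group_carrier Image_word_class
        braid_perm_class[OF _ VB_rels_subset] braid_perm_class)
  have Q_image: "Q = ?p ` VP n"
    unfolding Q VP_def kernel_def using perm by (auto simp flip: onto)
  have ker: "kernel (VB n) K ?p \<subseteq> ?D"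
  proof
    fix g assume "g \<in> kernel (VB n) K ?p"
    then obtain w where w: "w \<in> words ?X" "g = braid_class n w"
      and "word_class ?X R w = word_class ?X R []"
      using Image_word_class[OF R(1)]
      by (auto simp: kernel_def VB_def presented_group_carrier K presented_group_def quotient_def)
    then have "(w, []) \<in> word_cong ?X R"
      using word_cong.refl[of "[]" ?X R] by (auto intro: word_cong.sym)
    then have "?D #>\<^bsub>VB n\<^esub> g = ?D #>\<^bsub>VB n\<^esub> braid_class n []"
      unfolding w
      by (rule hom_respects_larger_cong[rotated 2])
        (use D.r_coset_hom_Mod R(2) UVB_rels_mod_derived in \<open>auto simp: VB_def\<close>)
    also have "braid_class n [] = \<one>\<^bsub>VB n\<^esub>"
      by (simp add: VB_def presented_group_def)
    also have "?D #>\<^bsub>VB n\<^esub> \<one>\<^bsub>VB n\<^esub> = ?D"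
      by (rule p.G.coset_mult_one[OF D.subset])
    finally have "?D #>\<^bsub>VB n\<^esub> g = ?D" .
    moreover have "g \<in> carrier (VB n)"
      using w by (simp add: VB_def word_class_closed)
    ultimately show "g \<in> ?D"
      by (rule p.G.coset_join1[OF _ _ D.subgroup_axioms])
  qed
  have "VP n \<subseteq> carrier (VB n)"
    by (auto simp: VP_def kernel_def)
  then show ?thesis
    using p.Mod_derived_iso[OF onto _ _ ker] N unfolding Q_image by blast
qed


section \<open>Welded and unrestricted virtual braid groups\<close>

theorem theorem5p1:
  fixes n :: nat
  assumes "n \<ge> 2"
  shows "(WB n Mod derived (WB n) (WP n)) \<cong> (VB n Mod derived (VB n) (VP n))
    \<and> (UVB n Mod derived (UVB n) (UVP n)) \<cong> (VB n Mod derived (VB n) (VP n))"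
proof
  show "(WB n Mod derived (WB n) (WP n)) \<cong> (VB n Mod derived (VB n) (VP n))"
    by (rule VB_quotient_mod_derived_iso[OF _ _ WB_def WP_def derived_pure_normal(2)])
      (auto simp: UVB_rels_def WB_rels_def)
  show "(UVB n Mod derived (UVB n) (UVP n)) \<cong> (VB n Mod derived (VB n) (VP n))"
    by (rule VB_quotient_mod_derived_iso[OF VB_rels_subset _ UVB_def UVP_def derived_pure_normal(3)])
      simp
qed

end
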